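(* Let $P$ be a dcpo satisfying the following condition: for every nonempty irreducible Scott closed proper subset $F$ of $P$ (i.e. $F\in Irr_\sigma(P)$, $F\neq P$), either $F$ is a down-linear element of the poset $Irr_\sigma(P)$, or $F$ is the supremum in $Irr_\sigma(P)$ of a directed set of down-linear elements of $Irr_\sigma(P)$. Then $P$ is SCL-faithful.
   Context: A dcpo is a poset in which every (nonempty) directed subset has a supremum. A subset $A$ of a dcpo $P$ is Scott closed if it is a lower set and $\bigvee D\in A$ for every directed $D\subseteq A$; the Scott closed sets are the closed sets of the Scott topology. $C_\sigma(P)$ is the lattice of all Scott closed subsets of $P$ ordered by inclusion. A subset $A$ of a topological space is irreducible if whenever $A\subseteq F_1\cup F_2$ with $F_1,F_2$ closed, then $A\subseteq F_1$ or $A\subseteq F_2$. $Irr_\sigma(P)$ is the set of all nonempty irreducible Scott closed subsets of $P$ (irreducible with respect to the Scott topology), ordered by inclusion; it is a dcpo. An element $a$ of a poset $R$ is down-linear if $\{x\in R: x\le a\}$ is a chain. A dcpo $P$ is SCL-faithful if for every dcpo $Q$, $C_\sigma(P)\cong C_\sigma(Q)$ (as lattices) implies $P\cong Q$ (as posets). *)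

theory Defs
  imports "HOL-Analysis.Abstract_Topology" "HOL-Algebra.Complete_Lattice"
begin

text \<open>Posets are records of type \<^typ>\<open>'a gorder\<close> satisfying \<^locale>\<open>partial_order\<close>, which forces
  the record's equivalence to be equality. The carrier, hence a dcpo, may be empty.\<close>

definition directed :: "('a, 'm) gorder_scheme \<Rightarrow> 'a set \<Rightarrow> bool" where
  "directed L D \<longleftrightarrow> D \<subseteq> carrier L \<and> D \<noteq> {} \<and>
     (\<forall>x\<in>D. \<forall>y\<in>D. \<exists>z\<in>D. x \<sqsubseteq>\<^bsub>L\<^esub> z \<and> y \<sqsubseteq>\<^bsub>L\<^esub> z)"

locale dcpo = partial_order L for L (structure) +
  assumes directed_sup: "directed L D \<Longrightarrow> \<exists>s. is_lub L s D"

definition down_linear :: "('a, 'm) gorder_scheme \<Rightarrow> 'a \<Rightarrow> bool" where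
  "down_linear R a \<longleftrightarrow>
     a \<in> carrier R \<and> Complete_Partial_Order.chain (le R) {x \<in> carrier R. x \<sqsubseteq>\<^bsub>R\<^esub> a}"

definition order_isomorphic :: "('a, 'm) gorder_scheme \<Rightarrow> ('b, 'n) gorder_scheme \<Rightarrow> bool" where
  "order_isomorphic A B \<longleftrightarrow> (\<exists>f. bij_betw f (carrier A) (carrier B) \<and> order_emb A B f)"

definition lattice_isomorphic :: "('a, 'm) gorder_scheme \<Rightarrow> ('b, 'n) gorder_scheme \<Rightarrow> bool" where
  "lattice_isomorphic A B \<longleftrightarrow>
     (\<exists>f. bij_betw f (carrier A) (carrier B) \<and> join_pres A B f \<and> meet_pres A B f)"

abbreviation inclusion_order :: "'a set set \<Rightarrow> 'a set gorder" where
  "inclusion_order \<A> \<equiv> \<lparr>carrier = \<A>, eq = (=), le = (\<subseteq>)\<rparr>"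

definition scott_closed :: "('a, 'm) gorder_scheme \<Rightarrow> 'a set \<Rightarrow> bool" where
  "scott_closed L A \<longleftrightarrow> A \<subseteq> carrier L \<and>
     (\<forall>x\<in>A. \<forall>y\<in>carrier L. y \<sqsubseteq>\<^bsub>L\<^esub> x \<longrightarrow> y \<in> A) \<and>
     (\<forall>D s. directed L D \<and> D \<subseteq> A \<and> is_lub L s D \<longrightarrow> s \<in> A)"

text \<open>The conditions for a topology, and that the closed sets are exactly the Scott closed
  ones, are proved for all posets in \<open>istopology_scott\<close> and \<open>closedin_scott\<close> below.\<close>

definition scott_topology :: "('a, 'm) gorder_scheme \<Rightarrow> 'a topology" where
  "scott_topology L = topology (\<lambda>U. U \<subseteq> carrier L \<and> scott_closed L (carrier L - U))"

definition irreducible_in :: "'a topology \<Rightarrow> 'a set \<Rightarrow> bool" where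
  "irreducible_in X A \<longleftrightarrow> A \<subseteq> topspace X \<and>
     (\<forall>F1 F2. closedin X F1 \<and> closedin X F2 \<and> A \<subseteq> F1 \<union> F2 \<longrightarrow> A \<subseteq> F1 \<or> A \<subseteq> F2)"

definition C_sigma :: "('a, 'm) gorder_scheme \<Rightarrow> 'a set gorder" where
  "C_sigma L = inclusion_order {A. scott_closed L A}"

definition Irr_sigma :: "('a, 'm) gorder_scheme \<Rightarrow> 'a set gorder" where
  "Irr_sigma L =
     inclusion_order {A. A \<noteq> {} \<and> scott_closed L A \<and> irreducible_in (scott_topology L) A}"

text \<open>A formula of HOL cannot quantify over types, so the type of the elements of the
  competing dcpos \<open>Q\<close> is a parameter. A theorem concluding \<open>SCL_faithful TYPE('b) P\<close> with
  \<open>'b\<close> an otherwise unconstrained type variable covers all dcpos \<open>Q\<close>.\<close>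

definition SCL_faithful :: "'b itself \<Rightarrow> ('a, 'm) gorder_scheme \<Rightarrow> bool" where
  "SCL_faithful TYPE('b) P \<longleftrightarrow>
     (\<forall>Q :: 'b gorder. dcpo Q \<longrightarrow> lattice_isomorphic (C_sigma P) (C_sigma Q) \<longrightarrow>
        order_isomorphic P Q)"

lemma scott_closed_Int:
  assumes "scott_closed L A" "scott_closed L B"
  shows "scott_closed L (A \<inter> B)"
  using assms unfolding scott_closed_def by blast

lemma scott_closed_Inter:
  assumes "\<And>A. A \<in> \<A> \<Longrightarrow> scott_closed L A" "\<A> \<noteq> {}"
  shows "scott_closed L (\<Inter>\<A>)"
  unfolding scott_closed_def
proof (intro conjI ballI allI impI)
  show "\<Inter>\<A> \<subseteq> carrier L"
    using assms unfolding scott_closed_def by blast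
next
  fix x y assume "x \<in> \<Inter>\<A>" "y \<in> carrier L" "y \<sqsubseteq>\<^bsub>L\<^esub> x"
  then show "y \<in> \<Inter>\<A>" using assms(1) unfolding scott_closed_def by blast
next
  fix D s assume *: "directed L D \<and> D \<subseteq> \<Inter>\<A> \<and> is_lub L s D"
  show "s \<in> \<Inter>\<A>"
  proof
    fix A assume "A \<in> \<A>"
    moreover from this have "D \<subseteq> A" using * by blast
    ultimately show "s \<in> A" using assms(1) * unfolding scott_closed_def by blast
  qed
qed

lemma scott_closed_carrier: "scott_closed L (carrier L)"
  unfolding scott_closed_def least_def Upper_def by blast

lemma scott_closed_empty: "scott_closed L {}"
  unfolding scott_closed_def directed_def by blast

lemma (in partial_order) scott_closed_Un:
  assumes A: "scott_closed L A" and B: "scott_closed L B"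
  shows "scott_closed L (A \<union> B)"
  unfolding scott_closed_def
proof (intro conjI ballI allI impI)
  show "A \<union> B \<subseteq> carrier L" using A B unfolding scott_closed_def by blast
next
  fix x y assume "x \<in> A \<union> B" "y \<in> carrier L" "y \<sqsubseteq> x"
  then show "y \<in> A \<union> B" using A B unfolding scott_closed_def by blast
next
  fix D s assume *: "directed L D \<and> D \<subseteq> A \<union> B \<and> is_lub L s D"
  have lower: "\<And>C x y. scott_closed L C \<Longrightarrow> x \<in> C \<Longrightarrow> y \<in> carrier L \<Longrightarrow> y \<sqsubseteq> x \<Longrightarrow> y \<in> C"
    unfolding scott_closed_def by blast
  have Dc: "D \<subseteq> carrier L" using * unfolding directed_def by blast
  have "D \<subseteq> A \<or> D \<subseteq> B"
  proof (rule ccontr)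
    assume "\<not> ?thesis"
    then obtain a b where ab: "a \<in> D" "a \<notin> A" "b \<in> D" "b \<notin> B" by blast
    then obtain c where c: "c \<in> D" "a \<sqsubseteq> c" "b \<sqsubseteq> c"
      using * unfolding directed_def by blast
    then have "c \<in> A \<or> c \<in> B" using * by blast
    then show False using lower[OF A _ _ c(2)] lower[OF B _ _ c(3)] ab Dc by blast
  qed
  then show "s \<in> A \<union> B" using A B * unfolding scott_closed_def by blast
qed

lemma (in partial_order) istopology_scott:
  "istopology (\<lambda>U. U \<subseteq> carrier L \<and> scott_closed L (carrier L - U))"
  unfolding istopology_def
proof (intro conjI allI impI)
  fix S T
  assume "S \<subseteq> carrier L \<and> scott_closed L (carrier L - S)"
    and "T \<subseteq> carrier L \<and> scott_closed L (carrier L - T)"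
  then show "S \<inter> T \<subseteq> carrier L" and "scott_closed L (carrier L - S \<inter> T)"
    using scott_closed_Un[of "carrier L - S" "carrier L - T"] by (auto simp: Diff_Int)
next
  fix \<K> assume *: "\<forall>K\<in>\<K>. K \<subseteq> carrier L \<and> scott_closed L (carrier L - K)"
  then show "\<Union>\<K> \<subseteq> carrier L" by blast
  show "scott_closed L (carrier L - \<Union>\<K>)"
  proof (cases "\<K> = {}")
    case True
    then show ?thesis by (simp add: scott_closed_carrier)
  next
    case False
    then have "scott_closed L (\<Inter>K\<in>\<K>. carrier L - K)"
      using * by (intro scott_closed_Inter) auto
    moreover have "carrier L - \<Union>\<K> = (\<Inter>K\<in>\<K>. carrier L - K)" using False by blast
    ultimately show ?thesis by simp
  qed
qed

lemma (in partial_order) topspace_scott: "topspace (scott_topology L) = carrier L"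
  unfolding topspace_def scott_topology_def topology_inverse'[OF istopology_scott]
  using scott_closed_empty by fastforce

lemma (in partial_order) closedin_scott:
  "closedin (scott_topology L) A \<longleftrightarrow> scott_closed L A"
proof -
  have "A \<subseteq> carrier L \<Longrightarrow> carrier L - (carrier L - A) = A" by blast
  then show ?thesis
    unfolding closedin_def topspace_scott
    unfolding scott_topology_def topology_inverse'[OF istopology_scott]
    by (auto simp: scott_closed_def)
qed

text \<open>\<^const>\<open>join_pres\<close> and \<^const>\<open>meet_pres\<close> presuppose lattices.\<close>

lemma partial_order_inclusion: "partial_order (inclusion_order \<A>)"
  by unfold_locales auto

lemma (in partial_order) lattice_C_sigma: "lattice (C_sigma L)"
proof -
  interpret C: partial_order "C_sigma L"
    unfolding C_sigma_def by (rule partial_order_inclusion)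
  show ?thesis
  proof
    fix A B assume "A \<in> carrier (C_sigma L)" "B \<in> carrier (C_sigma L)"
    then have AB: "scott_closed L A" "scott_closed L B" by (auto simp: C_sigma_def)
    have "is_lub (C_sigma L) (A \<union> B) {A, B}"
      using AB scott_closed_Un[OF AB] by (auto simp: C_sigma_def least_def Upper_def)
    then show "\<exists>s. is_lub (C_sigma L) s {A, B}" ..
    have "is_glb (C_sigma L) (A \<inter> B) {A, B}"
      using AB scott_closed_Int[OF AB] by (auto simp: C_sigma_def greatest_def Lower_def)
    then show "\<exists>s. is_glb (C_sigma L) s {A, B}" ..
  qed
qed

end

theory Submission
  imports Defs
begin

text \<open>
  The elements of a dcpo are recovered from its lattice of Scott closed sets as the principal
  ideals, so the question is whether an isomorphism \<open>f\<close> between the lattices of \<open>P\<close> and \<open>Q\<close>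
  preserves principal ideals. Irreducible closed sets are the nonzero coprime elements of the
  lattice; hence \<open>f\<close> preserves them, and with them the order-theoretic hypothesis of the theorem
  (\<open>down_linear_generated_transfer\<close>). So \<open>P\<close> and \<open>Q\<close> both satisfy it.

  In any dcpo the hypothesis makes every proper irreducible closed set \<open>F\<close> principal. If \<open>F\<close> is
  down-linear, the principal ideals below \<open>F\<close> form a chain, so \<open>F\<close> is itself a chain, thus
  directed, and by closedness it contains its supremum \<open>s\<close>: it is the ideal of \<open>s\<close>. A
  supremum of a directed family of principal ideals is the ideal of the supremum of the
  generators.

  Thus \<open>f\<close> and its inverse preserve the proper principal ideals. The set left over is the whole
  dcpo, which may or may not be principal: it is when there is a greatest element. Here
  \<open>greatest_element_transfer\<close> decides that \<open>P\<close> and \<open>Q\<close> agree. If \<open>Q\<close> has a greatest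
  element \<open>q\<close> but \<open>P\<close> has none, then the poset \<open>Q - {q}\<close> is a copy of the dcpo \<open>P\<close>, so it is
  Scott closed in \<open>Q\<close>, and \<open>Q\<close> has a largest proper closed set. But \<open>P\<close> has no largest proper
  closed set, for it would contain every principal ideal. Therefore \<open>f\<close> matches
  all principal ideals of \<open>P\<close> with those of \<open>Q\<close>, which is an isomorphism of \<open>P\<close> with \<open>Q\<close>.
\<close>

section \<open>Order isomorphisms\<close>

definition order_iso :: "('a, 'm) gorder_scheme \<Rightarrow> ('b, 'n) gorder_scheme \<Rightarrow> ('a \<Rightarrow> 'b) \<Rightarrow> bool" where
  "order_iso R S f \<longleftrightarrow> bij_betw f (carrier R) (carrier S) \<and> order_emb R S f"

lemma order_iso_closed: "order_iso R S f \<Longrightarrow> x \<in> carrier R \<Longrightarrow> f x \<in> carrier S"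
  unfolding order_iso_def by (meson bij_betwE)

lemma order_iso_le:
  "order_iso R S f \<Longrightarrow> x \<in> carrier R \<Longrightarrow> y \<in> carrier R \<Longrightarrow> f x \<sqsubseteq>\<^bsub>S\<^esub> f y \<longleftrightarrow> x \<sqsubseteq>\<^bsub>R\<^esub> y"
  unfolding order_iso_def order_emb_def by blast

lemma order_iso_surj:
  assumes "order_iso R S f" "y \<in> carrier S"
  obtains x where "x \<in> carrier R" "f x = y"
proof -
  have "y \<in> f ` carrier R"
    using assms bij_betw_imp_surj_on unfolding order_iso_def by metis
  then show thesis using that by blast
qed

lemma order_iso_inv_into:
  assumes f: "order_iso R S f"
  shows "order_iso S R (inv_into (carrier R) f)"
proof -
  have b: "bij_betw f (carrier R) (carrier S)" using f unfolding order_iso_def by blast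
  then have b': "bij_betw (inv_into (carrier R) f) (carrier S) (carrier R)"
    by (rule bij_betw_inv_into)
  have "order_emb S R (inv_into (carrier R) f)"
    unfolding order_emb_def
  proof (intro conjI ballI)
    show "weak_partial_order S" "weak_partial_order R"
      using f unfolding order_iso_def order_emb_def by blast+
    fix x y assume xy: "x \<in> carrier S" "y \<in> carrier S"
    then have "inv_into (carrier R) f x \<in> carrier R" "inv_into (carrier R) f y \<in> carrier R"
      using b' by (auto dest: bij_betw_apply)
    from order_iso_le[OF f this]
    show "inv_into (carrier R) f x \<sqsubseteq>\<^bsub>R\<^esub> inv_into (carrier R) f y \<longleftrightarrow> x \<sqsubseteq>\<^bsub>S\<^esub> y"
      using xy by (simp add: bij_betw_inv_into_right[OF b])
  qed
  with b' show ?thesis unfolding order_iso_def by blast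
qed

text \<open>The order can be read off the joins: \<open>x \<sqsubseteq> y\<close> amounts to \<open>x \<squnion> y = y\<close>.\<close>

lemma lattice_isomorphic_imp_order_iso:
  assumes "lattice_isomorphic A B"
  obtains f where "order_iso A B f"
proof -
  obtain f where b: "bij_betw f (carrier A) (carrier B)" and j: "join_pres A B f"
    using assms unfolding lattice_isomorphic_def by blast
  interpret A: lattice A using j unfolding join_pres_def by blast
  interpret B: lattice B using j unfolding join_pres_def by blast
  have "order_emb A B f"
    unfolding order_emb_def
  proof (intro conjI ballI)
    show "weak_partial_order A" "weak_partial_order B" by unfold_locales
    fix x y assume xy: "x \<in> carrier A" "y \<in> carrier A"
    then have fxy: "f x \<in> carrier B" "f y \<in> carrier B" using b by (meson bij_betwE)+
    have "x \<squnion>\<^bsub>A\<^esub> y \<in> carrier A" using xy by simp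
    then have "f (x \<squnion>\<^bsub>A\<^esub> y) = f y \<longleftrightarrow> x \<squnion>\<^bsub>A\<^esub> y = y"
      using inj_on_eq_iff[OF bij_betw_imp_inj_on[OF b]] xy by blast
    moreover have "f (x \<squnion>\<^bsub>A\<^esub> y) = f x \<squnion>\<^bsub>B\<^esub> f y" using j xy unfolding join_pres_def by blast
    ultimately show "f x \<sqsubseteq>\<^bsub>B\<^esub> f y \<longleftrightarrow> x \<sqsubseteq>\<^bsub>A\<^esub> y"
      using A.le_iff_meet[OF xy] B.le_iff_meet[OF fxy] by simp
  qed
  with b show thesis using that unfolding order_iso_def by blast
qed

lemma order_iso_down_linear:
  assumes f: "order_iso R S f" and a: "down_linear R a"
  shows "down_linear S (f a)"
  unfolding down_linear_def
proof
  have aR: "a \<in> carrier R" using a unfolding down_linear_def by blast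
  then show "f a \<in> carrier S" by (rule order_iso_closed[OF f])
  have ch: "Complete_Partial_Order.chain (le R) {x \<in> carrier R. x \<sqsubseteq>\<^bsub>R\<^esub> a}"
    using a unfolding down_linear_def by blast
  show "Complete_Partial_Order.chain (le S) {x \<in> carrier S. x \<sqsubseteq>\<^bsub>S\<^esub> f a}"
  proof (rule chainI)
    fix u v assume uv: "u \<in> {x \<in> carrier S. x \<sqsubseteq>\<^bsub>S\<^esub> f a}" "v \<in> {x \<in> carrier S. x \<sqsubseteq>\<^bsub>S\<^esub> f a}"
    obtain x where x: "x \<in> carrier R" "f x = u" using order_iso_surj[OF f] uv(1) by blast
    obtain y where y: "y \<in> carrier R" "f y = v" using order_iso_surj[OF f] uv(2) by blast
    have "x \<sqsubseteq>\<^bsub>R\<^esub> a" "y \<sqsubseteq>\<^bsub>R\<^esub> a"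
      using uv x y order_iso_le[OF f x(1) aR] order_iso_le[OF f y(1) aR] by auto
    then have "x \<sqsubseteq>\<^bsub>R\<^esub> y \<or> y \<sqsubseteq>\<^bsub>R\<^esub> x" using chainD[OF ch] x(1) y(1) by simp
    then show "u \<sqsubseteq>\<^bsub>S\<^esub> v \<or> v \<sqsubseteq>\<^bsub>S\<^esub> u"
      using order_iso_le[OF f x(1) y(1)] order_iso_le[OF f y(1) x(1)] x(2) y(2) by simp
  qed
qed

lemma directed_image:
  assumes D: "directed R D" and closed: "\<And>x. x \<in> D \<Longrightarrow> f x \<in> carrier S"
    and mono: "\<And>x y. x \<in> D \<Longrightarrow> y \<in> D \<Longrightarrow> x \<sqsubseteq>\<^bsub>R\<^esub> y \<Longrightarrow> f x \<sqsubseteq>\<^bsub>S\<^esub> f y"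
  shows "directed S (f ` D)"
  unfolding directed_def
proof (intro conjI ballI)
  show "f ` D \<subseteq> carrier S" using closed by blast
  show "f ` D \<noteq> {}" using D unfolding directed_def by blast
  fix u v assume "u \<in> f ` D" "v \<in> f ` D"
  then obtain x y where xy: "x \<in> D" "u = f x" "y \<in> D" "v = f y" by blast
  then obtain z where z: "z \<in> D" "x \<sqsubseteq>\<^bsub>R\<^esub> z" "y \<sqsubseteq>\<^bsub>R\<^esub> z" using D unfolding directed_def by blast
  then have "u \<sqsubseteq>\<^bsub>S\<^esub> f z" "v \<sqsubseteq>\<^bsub>S\<^esub> f z" using mono xy by simp_all
  then show "\<exists>w\<in>f ` D. u \<sqsubseteq>\<^bsub>S\<^esub> w \<and> v \<sqsubseteq>\<^bsub>S\<^esub> w" using z(1) by blast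
qed

lemma order_iso_directed:
  assumes f: "order_iso R S f" and D: "directed R D"
  shows "directed S (f ` D)"
proof (rule directed_image[OF D])
  have DR: "D \<subseteq> carrier R" using D unfolding directed_def by blast
  show "f x \<in> carrier S" if "x \<in> D" for x
    using order_iso_closed[OF f] that DR by blast
  show "f x \<sqsubseteq>\<^bsub>S\<^esub> f y" if "x \<in> D" "y \<in> D" "x \<sqsubseteq>\<^bsub>R\<^esub> y" for x y
    using order_iso_le[OF f subsetD[OF DR that(1)] subsetD[OF DR that(2)]] that(3) by simp
qed

lemma is_lub_iff:
  assumes "D \<subseteq> carrier L"
  shows "is_lub L s D \<longleftrightarrow> s \<in> carrier L \<and> (\<forall>x\<in>D. x \<sqsubseteq>\<^bsub>L\<^esub> s) \<and>
    (\<forall>u\<in>carrier L. (\<forall>x\<in>D. x \<sqsubseteq>\<^bsub>L\<^esub> u) \<longrightarrow> s \<sqsubseteq>\<^bsub>L\<^esub> u)"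
  using assms unfolding least_def Upper_def by blast

lemma order_iso_is_lub:
  assumes f: "order_iso R S f" and D: "D \<subseteq> carrier R" and s: "is_lub R s D"
  shows "is_lub S (f s) (f ` D)"
proof -
  have D': "f ` D \<subseteq> carrier S" using D order_iso_closed[OF f] by blast
  have sR: "s \<in> carrier R" using s is_lub_iff[OF D] by blast
  have "f s \<sqsubseteq>\<^bsub>S\<^esub> u" if u: "u \<in> carrier S" and ub: "\<forall>y\<in>f ` D. y \<sqsubseteq>\<^bsub>S\<^esub> u" for u
  proof -
    obtain v where v: "v \<in> carrier R" "f v = u" using order_iso_surj[OF f u] .
    then have "\<forall>x\<in>D. x \<sqsubseteq>\<^bsub>R\<^esub> v" using ub D order_iso_le[OF f] by blast
    then show ?thesis using s is_lub_iff[OF D] v order_iso_le[OF f sR] by blast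
  qed
  moreover have "f x \<sqsubseteq>\<^bsub>S\<^esub> f s" if "x \<in> D" for x
    using that D s is_lub_iff[OF D] order_iso_le[OF f _ sR] by blast
  ultimately show ?thesis
    using order_iso_closed[OF f sR] unfolding is_lub_iff[OF D'] by simp
qed

section \<open>Principal ideals and irreducible closed sets\<close>

definition principal_ideal :: "('a, 'm) gorder_scheme \<Rightarrow> 'a \<Rightarrow> 'a set" where
  "principal_ideal L x = {y \<in> carrier L. y \<sqsubseteq>\<^bsub>L\<^esub> x}"

context partial_order
begin

lemma Irr_sigma_iff:
  "A \<in> carrier (Irr_sigma L) \<longleftrightarrow> A \<noteq> {} \<and> scott_closed L A \<and>
     (\<forall>F1 F2. scott_closed L F1 \<and> scott_closed L F2 \<and> A \<subseteq> F1 \<union> F2 \<longrightarrow> A \<subseteq> F1 \<or> A \<subseteq> F2)"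
  unfolding Irr_sigma_def irreducible_in_def topspace_scott closedin_scott
  by (auto simp: scott_closed_def)

lemma principal_ideal_subset_iff:
  assumes "x \<in> carrier L" "y \<in> carrier L"
  shows "principal_ideal L x \<subseteq> principal_ideal L y \<longleftrightarrow> x \<sqsubseteq> y"
  using assms le_refl le_trans unfolding principal_ideal_def by blast

lemma principal_ideal_subset_closed_iff:
  assumes "x \<in> carrier L" "scott_closed L A"
  shows "principal_ideal L x \<subseteq> A \<longleftrightarrow> x \<in> A"
  using assms le_refl unfolding principal_ideal_def scott_closed_def by blast

lemma scott_closed_principal_ideal:
  assumes x: "x \<in> carrier L"
  shows "scott_closed L (principal_ideal L x)"
  unfolding scott_closed_def
proof (intro conjI ballI allI impI)
  show "principal_ideal L x \<subseteq> carrier L" unfolding principal_ideal_def by blast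
next
  fix a b assume "a \<in> principal_ideal L x" "b \<in> carrier L" "b \<sqsubseteq> a"
  then show "b \<in> principal_ideal L x"
    using x le_trans unfolding principal_ideal_def by blast
next
  fix D s assume "directed L D \<and> D \<subseteq> principal_ideal L x \<and> is_lub L s D"
  then show "s \<in> principal_ideal L x"
    using x is_lub_iff[of D L s] unfolding principal_ideal_def by blast
qed

lemma principal_ideal_in_Irr_sigma:
  assumes x: "x \<in> carrier L"
  shows "principal_ideal L x \<in> carrier (Irr_sigma L)"
  unfolding Irr_sigma_iff
proof (intro conjI allI impI)
  show "principal_ideal L x \<noteq> {}" using x le_refl unfolding principal_ideal_def by blast
  show "scott_closed L (principal_ideal L x)" using x by (rule scott_closed_principal_ideal)
  fix F1 F2
  assume F: "scott_closed L F1 \<and> scott_closed L F2 \<and> principal_ideal L x \<subseteq> F1 \<union> F2"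
  moreover have "x \<in> principal_ideal L x" using x le_refl unfolding principal_ideal_def by blast
  ultimately have "x \<in> F1 \<or> x \<in> F2" by blast
  with F show "principal_ideal L x \<subseteq> F1 \<or> principal_ideal L x \<subseteq> F2"
    by (simp add: principal_ideal_subset_closed_iff[OF x])
qed

end

lemma carrier_C_sigma: "A \<in> carrier (C_sigma L) \<longleftrightarrow> scott_closed L A"
  unfolding C_sigma_def by simp

lemma order_iso_C_sigma_subset:
  "order_iso (C_sigma P) (C_sigma Q) f \<Longrightarrow> scott_closed P A \<Longrightarrow> scott_closed P B \<Longrightarrow>
    f A \<subseteq> f B \<longleftrightarrow> A \<subseteq> B"
  using order_iso_le[of "C_sigma P" "C_sigma Q" f A B] by (simp add: C_sigma_def)

lemma order_iso_C_sigma_closed: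
  "order_iso (C_sigma P) (C_sigma Q) f \<Longrightarrow> scott_closed P A \<Longrightarrow> scott_closed Q (f A)"
  using order_iso_closed[of "C_sigma P" "C_sigma Q" f A] by (simp add: C_sigma_def)

lemma order_iso_C_sigma_surj:
  assumes "order_iso (C_sigma P) (C_sigma Q) f" "scott_closed Q B"
  obtains A where "scott_closed P A" "f A = B"
  using order_iso_surj[OF assms(1), of B] assms(2) by (auto simp: carrier_C_sigma)

lemma order_iso_C_sigma_inv:
  assumes "order_iso (C_sigma P) (C_sigma Q) f"
  obtains g where "order_iso (C_sigma Q) (C_sigma P) g"
    "\<And>A. scott_closed P A \<Longrightarrow> g (f A) = A" "\<And>B. scott_closed Q B \<Longrightarrow> f (g B) = B"
proof (rule that)
  have b: "bij_betw f (carrier (C_sigma P)) (carrier (C_sigma Q))"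
    using assms unfolding order_iso_def by blast
  show "order_iso (C_sigma Q) (C_sigma P) (inv_into (carrier (C_sigma P)) f)"
    using assms by (rule order_iso_inv_into)
  show "scott_closed P A \<Longrightarrow> inv_into (carrier (C_sigma P)) f (f A) = A" for A
    using bij_betw_inv_into_left[OF b] by (simp add: carrier_C_sigma)
  show "scott_closed Q B \<Longrightarrow> f (inv_into (carrier (C_sigma P)) f B) = B" for B
    using bij_betw_inv_into_right[OF b] by (simp add: carrier_C_sigma)
qed

lemma order_iso_C_sigma_carrier:
  assumes f: "order_iso (C_sigma P) (C_sigma Q) f"
  shows "f (carrier P) = carrier Q"
proof
  show "f (carrier P) \<subseteq> carrier Q"
    using order_iso_C_sigma_closed[OF f scott_closed_carrier] unfolding scott_closed_def by blast
  obtain A where A: "scott_closed P A" "f A = carrier Q"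
    using order_iso_C_sigma_surj[OF f scott_closed_carrier] .
  then have "A \<subseteq> carrier P" unfolding scott_closed_def by blast
  then show "carrier Q \<subseteq> f (carrier P)"
    using order_iso_C_sigma_subset[OF f A(1) scott_closed_carrier] A(2) by blast
qed

lemma order_iso_C_sigma_empty:
  assumes f: "order_iso (C_sigma P) (C_sigma Q) f"
  shows "f {} = {}"
proof -
  obtain A where A: "scott_closed P A" "f A = {}"
    using order_iso_C_sigma_surj[OF f scott_closed_empty] .
  then show ?thesis
    using order_iso_C_sigma_subset[OF f scott_closed_empty A(1)] by blast
qed

text \<open>Since binary unions are the joins of the lattice of closed sets, irreducibility is a
  property of the order alone.\<close>

lemma order_iso_C_sigma_Irr_sigma_closed:
  assumes P: "partial_order P" and Q: "partial_order Q"
    and f: "order_iso (C_sigma P) (C_sigma Q) f" and A: "A \<in> carrier (Irr_sigma P)"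
  shows "f A \<in> carrier (Irr_sigma Q)"
proof -
  interpret P: partial_order P by (rule P)
  interpret Q: partial_order Q by (rule Q)
  note sub = order_iso_C_sigma_subset[OF f]
  have Ac: "scott_closed P A" and "A \<noteq> {}" using A unfolding P.Irr_sigma_iff by blast+
  then have "f A \<noteq> {}"
    using sub[OF Ac scott_closed_empty] order_iso_C_sigma_empty[OF f] by blast
  moreover have "f A \<subseteq> G1 \<or> f A \<subseteq> G2"
    if G: "scott_closed Q G1" "scott_closed Q G2" and AG: "f A \<subseteq> G1 \<union> G2" for G1 G2
  proof -
    obtain F1 where F1: "scott_closed P F1" "f F1 = G1" using order_iso_C_sigma_surj[OF f G(1)] .
    obtain F2 where F2: "scott_closed P F2" "f F2 = G2" using order_iso_C_sigma_surj[OF f G(2)] .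
    have F: "scott_closed P (F1 \<union> F2)" using F1 F2 P.scott_closed_Un by blast
    \<comment> \<open>Monotonicity of \<open>f\<close> gives this half of the preservation of unions; it is the half that
      pulls the covering back to \<open>P\<close>.\<close>
    have "G1 \<union> G2 \<subseteq> f (F1 \<union> F2)" using sub[OF F1(1) F] sub[OF F2(1) F] F1(2) F2(2) by blast
    then have "A \<subseteq> F1 \<union> F2" using AG sub[OF Ac F] by blast
    then have "A \<subseteq> F1 \<or> A \<subseteq> F2" using A F1(1) F2(1) unfolding P.Irr_sigma_iff by blast
    then show ?thesis using sub[OF Ac F1(1)] sub[OF Ac F2(1)] F1(2) F2(2) by blast
  qed
  ultimately show ?thesis
    using order_iso_C_sigma_closed[OF f Ac] unfolding Q.Irr_sigma_iff by blast
qed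

lemma order_iso_C_sigma_Irr_sigma:
  assumes P: "partial_order P" and Q: "partial_order Q"
    and f: "order_iso (C_sigma P) (C_sigma Q) f"
  shows "order_iso (Irr_sigma P) (Irr_sigma Q) f"
proof -
  interpret P: partial_order P by (rule P)
  interpret Q: partial_order Q by (rule Q)
  obtain g where g: "order_iso (C_sigma Q) (C_sigma P) g"
    and gf: "\<And>A. scott_closed P A \<Longrightarrow> g (f A) = A" and fg: "\<And>B. scott_closed Q B \<Longrightarrow> f (g B) = B"
    using order_iso_C_sigma_inv[OF f] by metis
  have "bij_betw f (carrier (Irr_sigma P)) (carrier (Irr_sigma Q))"
  proof (rule bij_betw_byWitness[where f' = g])
    show "\<forall>A\<in>carrier (Irr_sigma P). g (f A) = A" using gf by (auto simp: P.Irr_sigma_iff)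
    show "\<forall>B\<in>carrier (Irr_sigma Q). f (g B) = B" using fg by (auto simp: Q.Irr_sigma_iff)
    show "f ` carrier (Irr_sigma P) \<subseteq> carrier (Irr_sigma Q)"
      using order_iso_C_sigma_Irr_sigma_closed[OF P Q f] by blast
    show "g ` carrier (Irr_sigma Q) \<subseteq> carrier (Irr_sigma P)"
      using order_iso_C_sigma_Irr_sigma_closed[OF Q P g] by blast
  qed
  moreover have "order_emb (Irr_sigma P) (Irr_sigma Q) f"
    unfolding order_emb_def
  proof (intro conjI ballI)
    show "weak_partial_order (Irr_sigma P)" "weak_partial_order (Irr_sigma Q)"
      unfolding Irr_sigma_def by (rule partial_order.axioms(1)[OF partial_order_inclusion])+
    fix A B assume "A \<in> carrier (Irr_sigma P)" "B \<in> carrier (Irr_sigma P)"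
    then have "scott_closed P A" "scott_closed P B" by (simp_all add: P.Irr_sigma_iff)
    then have "f A \<subseteq> f B \<longleftrightarrow> A \<subseteq> B" by (rule order_iso_C_sigma_subset[OF f])
    then show "f A \<sqsubseteq>\<^bsub>Irr_sigma Q\<^esub> f B \<longleftrightarrow> A \<sqsubseteq>\<^bsub>Irr_sigma P\<^esub> B"
      by (simp add: Irr_sigma_def)
  qed
  ultimately show ?thesis unfolding order_iso_def by blast
qed

section \<open>Proper irreducible closed sets are principal\<close>

definition proper_irreducibles_principal :: "('a, 'm) gorder_scheme \<Rightarrow> bool" where
  "proper_irreducibles_principal L \<longleftrightarrow>
    (\<forall>F\<in>carrier (Irr_sigma L). F \<noteq> carrier L \<longrightarrow> (\<exists>x\<in>carrier L. F = principal_ideal L x))"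

text \<open>The hypothesis of the theorem, as a property of a dcpo that can be transferred.\<close>

definition down_linear_generated :: "('a, 'm) gorder_scheme \<Rightarrow> bool" where
  "down_linear_generated L \<longleftrightarrow>
    (\<forall>F\<in>carrier (Irr_sigma L). F \<noteq> carrier L \<longrightarrow>
      down_linear (Irr_sigma L) F \<or>
      (\<exists>\<D>. directed (Irr_sigma L) \<D> \<and> (\<forall>G\<in>\<D>. down_linear (Irr_sigma L) G) \<and>
           is_lub (Irr_sigma L) F \<D>))"

context dcpo
begin

text \<open>The embedding \<open>x \<mapsto> principal_ideal L x\<close> reflects the order, so a down-linear \<open>F\<close> is
  a chain of elements, and its supremum, a member by closedness, generates it.\<close>

lemma down_linear_imp_principal:
  assumes F: "down_linear (Irr_sigma L) F"
  shows "\<exists>x\<in>carrier L. F = principal_ideal L x"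
proof -
  have Fi: "F \<in> carrier (Irr_sigma L)"
    and ch: "Complete_Partial_Order.chain (\<subseteq>) {G \<in> carrier (Irr_sigma L). G \<subseteq> F}"
    using F unfolding down_linear_def by (auto simp: Irr_sigma_def)
  have Fc: "scott_closed L F" and "F \<noteq> {}" using Fi unfolding Irr_sigma_iff by blast+
  have FL: "F \<subseteq> carrier L" using Fc unfolding scott_closed_def by blast
  have "x \<sqsubseteq> y \<or> y \<sqsubseteq> x" if "x \<in> F" "y \<in> F" for x y
  proof -
    have "principal_ideal L x \<in> {G \<in> carrier (Irr_sigma L). G \<subseteq> F}"
      and "principal_ideal L y \<in> {G \<in> carrier (Irr_sigma L). G \<subseteq> F}"
      using that FL principal_ideal_in_Irr_sigma principal_ideal_subset_closed_iff[OF _ Fc] by blast+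
    from chainD[OF ch this] show ?thesis
      using principal_ideal_subset_iff[of x y] principal_ideal_subset_iff[of y x] that FL by blast
  qed
  then have "\<exists>z\<in>F. x \<sqsubseteq> z \<and> y \<sqsubseteq> z" if "x \<in> F" "y \<in> F" for x y
    using that le_refl[OF subsetD[OF FL]] by metis
  then have D: "directed L F" using FL \<open>F \<noteq> {}\<close> unfolding directed_def by blast
  then obtain s where s: "is_lub L s F" using directed_sup by blast
  then have sF: "s \<in> F" using Fc D unfolding scott_closed_def by blast
  have "F \<subseteq> principal_ideal L s"
    using s FL unfolding is_lub_iff[OF FL] principal_ideal_def by blast
  moreover have "principal_ideal L s \<subseteq> F"
    using principal_ideal_subset_closed_iff[OF _ Fc, of s] sF FL by blast
  ultimately have "F = principal_ideal L s" by (rule subset_antisym)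
  then show ?thesis using sF FL by blast
qed

lemma directed_generators:
  assumes D: "directed (Irr_sigma L) \<D>" and pr: "\<forall>G\<in>\<D>. \<exists>x\<in>carrier L. G = principal_ideal L x"
  shows "directed L {x \<in> carrier L. principal_ideal L x \<in> \<D>}"
  unfolding directed_def
proof (intro conjI ballI)
  obtain G where "G \<in> \<D>" using D unfolding directed_def by blast
  with pr show "{x \<in> carrier L. principal_ideal L x \<in> \<D>} \<noteq> {}" by auto
next
  fix x y assume x: "x \<in> {x \<in> carrier L. principal_ideal L x \<in> \<D>}"
    and y: "y \<in> {x \<in> carrier L. principal_ideal L x \<in> \<D>}"
  then obtain G where G: "G \<in> \<D>" "principal_ideal L x \<subseteq> G" "principal_ideal L y \<subseteq> G"
    using D unfolding directed_def by (simp add: Irr_sigma_def) metis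
  then obtain z where z: "z \<in> carrier L" "G = principal_ideal L z" using pr by blast
  then have "x \<sqsubseteq> z" "y \<sqsubseteq> z" using G x y by (simp_all add: principal_ideal_subset_iff)
  then show "\<exists>z\<in>{x \<in> carrier L. principal_ideal L x \<in> \<D>}. x \<sqsubseteq> z \<and> y \<sqsubseteq> z"
    using G(1) z by blast
qed blast

text \<open>The supremum \<open>s\<close> of the generators lies in every closed set that contains all the given
  ideals, hence in \<open>F\<close>; and the ideal of \<open>s\<close> is an irreducible upper bound of them, hence
  contains \<open>F\<close>.\<close>

lemma is_lub_principal_imp_principal:
  assumes D: "directed (Irr_sigma L) \<D>" and pr: "\<forall>G\<in>\<D>. \<exists>x\<in>carrier L. G = principal_ideal L x"
    and F: "is_lub (Irr_sigma L) F \<D>"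
  shows "\<exists>x\<in>carrier L. F = principal_ideal L x"
proof -
  let ?D = "{x \<in> carrier L. principal_ideal L x \<in> \<D>}"
  have DI: "\<D> \<subseteq> carrier (Irr_sigma L)" using D unfolding directed_def by blast
  have dir: "directed L ?D" using D pr by (rule directed_generators)
  then obtain s where s: "is_lub L s ?D" using directed_sup by blast
  have sD: "s \<in> carrier L" "\<forall>x\<in>?D. x \<sqsubseteq> s" using s by (simp_all add: is_lub_iff)
  have Fi: "F \<in> carrier (Irr_sigma L)" and ub: "\<forall>G\<in>\<D>. G \<subseteq> F"
    and lst: "\<And>H. H \<in> carrier (Irr_sigma L) \<Longrightarrow> \<forall>G\<in>\<D>. G \<subseteq> H \<Longrightarrow> F \<subseteq> H"
    using F is_lub_iff[OF DI] by (auto simp: Irr_sigma_def)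
  have Fc: "scott_closed L F" using Fi unfolding Irr_sigma_iff by blast
  have "\<forall>G\<in>\<D>. G \<subseteq> principal_ideal L s"
  proof
    fix G assume G: "G \<in> \<D>"
    then obtain x where x: "x \<in> carrier L" "G = principal_ideal L x" using pr by blast
    then have "x \<sqsubseteq> s" using G sD(2) by blast
    then show "G \<subseteq> principal_ideal L s" using x sD(1) by (simp add: principal_ideal_subset_iff)
  qed
  then have "F \<subseteq> principal_ideal L s" using lst[OF principal_ideal_in_Irr_sigma[OF sD(1)]] by blast
  moreover have "?D \<subseteq> F" using ub by (auto simp: principal_ideal_subset_closed_iff[OF _ Fc])
  then have "s \<in> F" using s dir Fc unfolding scott_closed_def by blast
  ultimately show ?thesis using principal_ideal_subset_closed_iff[OF sD(1) Fc] sD(1) by auto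
qed

lemma down_linear_generated_imp_proper_irreducibles_principal:
  assumes "down_linear_generated L"
  shows "proper_irreducibles_principal L"
  unfolding proper_irreducibles_principal_def
proof (intro ballI impI)
  fix F assume "F \<in> carrier (Irr_sigma L)" "F \<noteq> carrier L"
  then consider "down_linear (Irr_sigma L) F"
    | \<D> where "directed (Irr_sigma L) \<D>" "\<forall>G\<in>\<D>. down_linear (Irr_sigma L) G"
        "is_lub (Irr_sigma L) F \<D>"
    using assms unfolding down_linear_generated_def by blast
  then show "\<exists>x\<in>carrier L. F = principal_ideal L x"
    by cases (blast intro: down_linear_imp_principal is_lub_principal_imp_principal)+
qed

end

lemma down_linear_generated_transfer:
  assumes P: "partial_order P" and Q: "partial_order Q"
    and f: "order_iso (C_sigma P) (C_sigma Q) f" and gen: "down_linear_generated P"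
  shows "down_linear_generated Q"
  unfolding down_linear_generated_def
proof (intro ballI impI)
  note fI = order_iso_C_sigma_Irr_sigma[OF P Q f]
  fix H assume H: "H \<in> carrier (Irr_sigma Q)" "H \<noteq> carrier Q"
  obtain F where F: "F \<in> carrier (Irr_sigma P)" "f F = H" using order_iso_surj[OF fI H(1)] .
  then have "F \<noteq> carrier P" using H(2) order_iso_C_sigma_carrier[OF f] by blast
  then consider "down_linear (Irr_sigma P) F"
    | \<D> where "directed (Irr_sigma P) \<D>" "\<forall>G\<in>\<D>. down_linear (Irr_sigma P) G"
        "is_lub (Irr_sigma P) F \<D>"
    using gen F(1) unfolding down_linear_generated_def by blast
  then show "down_linear (Irr_sigma Q) H \<or>
      (\<exists>\<D>. directed (Irr_sigma Q) \<D> \<and> (\<forall>G\<in>\<D>. down_linear (Irr_sigma Q) G) \<and>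
           is_lub (Irr_sigma Q) H \<D>)"
  proof cases
    case 1
    then show ?thesis using order_iso_down_linear[OF fI] F(2) by blast
  next
    case 2
    then have "\<D> \<subseteq> carrier (Irr_sigma P)" unfolding directed_def by blast
    then have "is_lub (Irr_sigma Q) H (f ` \<D>)"
      using order_iso_is_lub[OF fI] 2(3) F(2) by blast
    moreover have "directed (Irr_sigma Q) (f ` \<D>)" using order_iso_directed[OF fI] 2(1) .
    moreover have "\<forall>G\<in>f ` \<D>. down_linear (Irr_sigma Q) G"
      using order_iso_down_linear[OF fI] 2(2) by blast
    ultimately show ?thesis by blast
  qed
qed

section \<open>Recovering the dcpo\<close>

lemma proper_principal_ideal_image:
  assumes P: "partial_order P" and Q: "partial_order Q"
    and f: "order_iso (C_sigma P) (C_sigma Q) f" and prQ: "proper_irreducibles_principal Q"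
    and x: "x \<in> carrier P" "principal_ideal P x \<noteq> carrier P"
  shows "\<exists>y\<in>carrier Q. principal_ideal Q y \<noteq> carrier Q \<and> f (principal_ideal P x) = principal_ideal Q y"
proof -
  interpret P: partial_order P by (rule P)
  interpret Q: partial_order Q by (rule Q)
  have "f (principal_ideal P x) \<in> carrier (Irr_sigma Q)"
    using order_iso_C_sigma_Irr_sigma_closed[OF P Q f] P.principal_ideal_in_Irr_sigma x(1) by blast
  moreover have "f (principal_ideal P x) \<noteq> carrier Q"
  proof
    assume "f (principal_ideal P x) = carrier Q"
    then have "carrier P \<subseteq> principal_ideal P x"
      using order_iso_C_sigma_subset[OF f scott_closed_carrier P.scott_closed_principal_ideal[OF x(1)]]
        order_iso_C_sigma_carrier[OF f] by simp
    then show False using x(2) unfolding principal_ideal_def by blast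
  qed
  ultimately show ?thesis using prQ unfolding proper_irreducibles_principal_def by metis
qed

text \<open>Deleting the greatest element \<open>q\<close> of \<open>Q\<close> leaves a closed set: if \<open>P\<close> had no greatest
  element, the principal ideals of members of a directed \<open>D \<subseteq> Q - {q}\<close> would correspond to
  proper principal ideals of \<open>P\<close>, whose generators have a supremum \<open>x\<close>, and the image of the
  ideal of \<open>x\<close> is again proper, so that \<open>D\<close> has an upper bound other than \<open>q\<close>. The closed set
  of \<open>P\<close> corresponding to \<open>Q - {q}\<close> then contains all principal ideals of \<open>P\<close>, and so it is
  \<open>P\<close>, although \<open>Q - {q}\<close> is not \<open>Q\<close>.\<close>

lemma greatest_element_transfer:
  assumes P: "dcpo P" and Q: "dcpo Q"
    and f: "order_iso (C_sigma P) (C_sigma Q) f"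
    and prP: "proper_irreducibles_principal P" and prQ: "proper_irreducibles_principal Q"
    and q: "q \<in> carrier Q" "principal_ideal Q q = carrier Q"
  shows "\<exists>p\<in>carrier P. principal_ideal P p = carrier P"
proof (rule ccontr)
  assume "\<not> ?thesis"
  then have noP: "\<And>x. x \<in> carrier P \<Longrightarrow> principal_ideal P x \<noteq> carrier P" by blast
  interpret P: dcpo P by (rule P)
  interpret Q: dcpo Q by (rule Q)
  note po = P.partial_order_axioms Q.partial_order_axioms
  obtain g where g: "order_iso (C_sigma Q) (C_sigma P) g"
    and fg: "\<And>B. scott_closed Q B \<Longrightarrow> f (g B) = B"
    using order_iso_C_sigma_inv[OF f] by metis
  have top: "\<And>y. y \<in> carrier Q \<Longrightarrow> y \<sqsubseteq>\<^bsub>Q\<^esub> q" using q(2) unfolding principal_ideal_def by blast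
  have proper: "principal_ideal Q y \<noteq> carrier Q \<longleftrightarrow> y \<noteq> q" if "y \<in> carrier Q" for y
    using that q top Q.le_antisym unfolding principal_ideal_def by blast
  let ?G = "carrier Q - {q}"
  have G: "scott_closed Q ?G"
    unfolding scott_closed_def
  proof (intro conjI ballI allI impI)
    fix x y assume "x \<in> ?G" "y \<in> carrier Q" "y \<sqsubseteq>\<^bsub>Q\<^esub> x"
    then show "y \<in> ?G" using top Q.le_antisym q(1) by blast
  next
    fix D s assume *: "directed Q D \<and> D \<subseteq> ?G \<and> is_lub Q s D"
    then have DQ: "D \<subseteq> carrier Q" by blast
    have s: "s \<in> carrier Q" and lst: "\<And>u. u \<in> carrier Q \<Longrightarrow> \<forall>d\<in>D. d \<sqsubseteq>\<^bsub>Q\<^esub> u \<Longrightarrow> s \<sqsubseteq>\<^bsub>Q\<^esub> u"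
      using * is_lub_iff[OF DQ] by blast+
    have "\<forall>d\<in>D. \<exists>x\<in>carrier P. g (principal_ideal Q d) = principal_ideal P x"
    proof
      fix d assume "d \<in> D"
      then have "d \<in> carrier Q" "principal_ideal Q d \<noteq> carrier Q" using * proper by blast+
      from proper_principal_ideal_image[OF po(2,1) g prP this]
      show "\<exists>x\<in>carrier P. g (principal_ideal Q d) = principal_ideal P x" by blast
    qed
    then obtain h where h: "\<And>d. d \<in> D \<Longrightarrow> h d \<in> carrier P"
      "\<And>d. d \<in> D \<Longrightarrow> g (principal_ideal Q d) = principal_ideal P (h d)" by metis
    have hle: "h d \<sqsubseteq>\<^bsub>P\<^esub> h e" if "d \<in> D" "e \<in> D" "d \<sqsubseteq>\<^bsub>Q\<^esub> e" for d e
    proof -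
      have "principal_ideal Q d \<subseteq> principal_ideal Q e"
        using that DQ Q.principal_ideal_subset_iff[of d e] by blast
      then have "g (principal_ideal Q d) \<subseteq> g (principal_ideal Q e)"
        using order_iso_C_sigma_subset[OF g, of "principal_ideal Q d" "principal_ideal Q e"]
          Q.scott_closed_principal_ideal that DQ by blast
      then show ?thesis using h that by (simp add: P.principal_ideal_subset_iff)
    qed
    have "directed Q D" using * by blast
    then have "directed P (h ` D)" using h(1) hle by (rule directed_image)
    then obtain x where "is_lub P x (h ` D)" using P.directed_sup by blast
    then have x: "x \<in> carrier P" "\<And>d. d \<in> D \<Longrightarrow> h d \<sqsubseteq>\<^bsub>P\<^esub> x"
      using h(1) by (simp_all add: is_lub_iff image_subset_iff)
    obtain y where y: "y \<in> carrier Q" "y \<noteq> q" "f (principal_ideal P x) = principal_ideal Q y"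
      using proper_principal_ideal_image[OF po f prQ x(1) noP[OF x(1)]] proper by blast
    have "d \<sqsubseteq>\<^bsub>Q\<^esub> y" if d: "d \<in> D" for d
    proof -
      have "principal_ideal P (h d) \<subseteq> principal_ideal P x"
        using h(1)[OF d] x(1) x(2)[OF d] by (simp add: P.principal_ideal_subset_iff)
      then have "f (principal_ideal P (h d)) \<subseteq> f (principal_ideal P x)"
        using h(1)[OF d] x(1)
        by (simp add: order_iso_C_sigma_subset[OF f] P.scott_closed_principal_ideal)
      moreover have "f (principal_ideal P (h d)) = principal_ideal Q d"
        using fg[OF Q.scott_closed_principal_ideal[OF subsetD[OF DQ d]]] h(2)[OF d] by simp
      ultimately have "principal_ideal Q d \<subseteq> principal_ideal Q y" using y(3) by simp
      then show ?thesis using Q.principal_ideal_subset_iff[OF subsetD[OF DQ d] y(1)] by simp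
    qed
    then have "s \<sqsubseteq>\<^bsub>Q\<^esub> y" using lst[OF y(1)] by blast
    then have "s \<noteq> q" using top Q.le_antisym y q(1) by blast
    then show "s \<in> ?G" using s by blast
  qed blast
  have "carrier P \<subseteq> g ?G"
  proof
    fix x assume x: "x \<in> carrier P"
    obtain y where y: "y \<in> carrier Q" "y \<noteq> q" "f (principal_ideal P x) = principal_ideal Q y"
      using proper_principal_ideal_image[OF po f prQ x noP[OF x]] proper by blast
    then have "f (principal_ideal P x) \<subseteq> f (g ?G)"
      using Q.principal_ideal_subset_closed_iff[OF y(1) G] fg[OF G] by auto
    then have "principal_ideal P x \<subseteq> g ?G"
      using order_iso_C_sigma_subset[OF f P.scott_closed_principal_ideal[OF x]
        order_iso_C_sigma_closed[OF g G]] by blast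
    then show "x \<in> g ?G"
      using P.principal_ideal_subset_closed_iff[OF x order_iso_C_sigma_closed[OF g G]] by blast
  qed
  then have "f (carrier P) \<subseteq> f (g ?G)"
    using order_iso_C_sigma_subset[OF f scott_closed_carrier order_iso_C_sigma_closed[OF g G]] by blast
  then show False using order_iso_C_sigma_carrier[OF f] fg[OF G] q(1) by blast
qed

lemma principal_ideal_image:
  assumes P: "dcpo P" and Q: "dcpo Q"
    and f: "order_iso (C_sigma P) (C_sigma Q) f"
    and prP: "proper_irreducibles_principal P" and prQ: "proper_irreducibles_principal Q"
    and x: "x \<in> carrier P"
  shows "\<exists>y\<in>carrier Q. f (principal_ideal P x) = principal_ideal Q y"
proof (cases "principal_ideal P x = carrier P")
  case True
  obtain g where "order_iso (C_sigma Q) (C_sigma P) g"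
    using order_iso_inv_into[OF f] by blast
  from greatest_element_transfer[OF Q P this prQ prP x True]
  show ?thesis using True order_iso_C_sigma_carrier[OF f] by metis
next
  case False
  have "partial_order P" "partial_order Q" using P Q by (auto dest: dcpo.axioms(1))
  from proper_principal_ideal_image[OF this f prQ x False] show ?thesis by blast
qed

lemma order_isomorphic_of_proper_irreducibles_principal:
  assumes P: "dcpo P" and Q: "dcpo Q"
    and f: "order_iso (C_sigma P) (C_sigma Q) f"
    and prP: "proper_irreducibles_principal P" and prQ: "proper_irreducibles_principal Q"
  shows "order_isomorphic P Q"
proof -
  interpret P: dcpo P by (rule P)
  interpret Q: dcpo Q by (rule Q)
  obtain g where g: "order_iso (C_sigma Q) (C_sigma P) g"
    and fg: "\<And>B. scott_closed Q B \<Longrightarrow> f (g B) = B"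
    using order_iso_C_sigma_inv[OF f] by metis
  obtain h where h: "\<And>x. x \<in> carrier P \<Longrightarrow> h x \<in> carrier Q"
    "\<And>x. x \<in> carrier P \<Longrightarrow> f (principal_ideal P x) = principal_ideal Q (h x)"
    using principal_ideal_image[OF P Q f prP prQ] by metis
  have emb: "h x \<sqsubseteq>\<^bsub>Q\<^esub> h y \<longleftrightarrow> x \<sqsubseteq>\<^bsub>P\<^esub> y" if "x \<in> carrier P" "y \<in> carrier P" for x y
    using order_iso_C_sigma_subset[OF f P.scott_closed_principal_ideal[OF that(1)]
        P.scott_closed_principal_ideal[OF that(2)]]
      h[OF that(1)] h[OF that(2)] that
    by (simp add: P.principal_ideal_subset_iff Q.principal_ideal_subset_iff)
  have "inj_on h (carrier P)"
  proof (rule inj_onI)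
    fix x y assume xy: "x \<in> carrier P" "y \<in> carrier P" "h x = h y"
    then show "x = y"
      using emb[OF xy(1,2)] emb[OF xy(2,1)] Q.le_refl[OF h(1)] P.le_antisym by metis
  qed
  moreover have "carrier Q \<subseteq> h ` carrier P"
  proof
    fix y assume y: "y \<in> carrier Q"
    obtain x where x: "x \<in> carrier P" "g (principal_ideal Q y) = principal_ideal P x"
      using principal_ideal_image[OF Q P g prQ prP y] by blast
    then have "principal_ideal Q y = principal_ideal Q (h x)"
      using h(2) fg Q.scott_closed_principal_ideal y by metis
    then have "y = h x"
      using Q.principal_ideal_subset_iff[of y "h x"] Q.principal_ideal_subset_iff[of "h x" y]
        Q.le_antisym y h(1)[OF x(1)] by simp
    then show "y \<in> h ` carrier P" using x(1) by blast
  qed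
  ultimately have "bij_betw h (carrier P) (carrier Q)" using h(1) unfolding bij_betw_def by blast
  moreover have "order_emb P Q h"
    using emb P.weak_partial_order_axioms Q.weak_partial_order_axioms unfolding order_emb_def by blast
  ultimately show ?thesis unfolding order_isomorphic_def by blast
qed

theorem theorem3p5:
  fixes P :: "'a gorder"
  assumes "dcpo P"
    and "\<And>F. F \<in> carrier (Irr_sigma P) \<Longrightarrow> F \<noteq> carrier P \<Longrightarrow>
      down_linear (Irr_sigma P) F \<or>
      (\<exists>\<D>. directed (Irr_sigma P) \<D> \<and> (\<forall>G\<in>\<D>. down_linear (Irr_sigma P) G) \<and>
           is_lub (Irr_sigma P) F \<D>)"
  shows "SCL_faithful TYPE('b) P"
  unfolding SCL_faithful_def
proof (intro allI impI)
  fix Q :: "'b gorder"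
  assume Q: "dcpo Q" and "lattice_isomorphic (C_sigma P) (C_sigma Q)"
  then obtain f where f: "order_iso (C_sigma P) (C_sigma Q) f"
    by (blast elim: lattice_isomorphic_imp_order_iso)
  have genP: "down_linear_generated P"
    using assms(2) unfolding down_linear_generated_def by blast
  have genQ: "down_linear_generated Q"
    by (rule down_linear_generated_transfer
        [OF dcpo.axioms(1)[OF assms(1)] dcpo.axioms(1)[OF Q] f genP])
  show "order_isomorphic P Q"
    by (rule order_isomorphic_of_proper_irreducibles_principal[OF assms(1) Q f])
      (rule dcpo.down_linear_generated_imp_proper_irreducibles_principal, fact+)+
qed

end
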